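(* For every graph $\Gamma$ there exists a graph $\Gamma'$ such that $\Gamma'$ admits a partial orientation as a quasi-transitive mixed graph and $\Gamma$ is an induced subgraph of $\Gamma'$.
   Context: A mixed graph has a vertex set, a set of (undirected) edges and a set of arcs, with at most one edge or arc between any pair of vertices. A partial orientation of a graph $\Gamma$ is a mixed graph obtained from $\Gamma$ by orienting some (possibly none or all) of its edges as arcs. A $2$-dipath is a directed path $uvw$ consisting of arcs $u\to v$ and $v\to w$; it is induced if $u$ and $w$ are not joined by an edge or arc. A mixed graph $H$ is quasi-transitive when (1) $H$ has no induced $2$-dipath, and (2) for every edge $uv$ of $H$ there is a vertex $w$ such that $uwv$ or $vwu$ is a $2$-dipath. *)

theory Defs
  imports Main
begin

record 'a ugraph =
  verts :: "'a set"
  edges :: "'a set set"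

definition simple_graph :: "('a, 'b) ugraph_scheme \<Rightarrow> bool" where
  "simple_graph G \<longleftrightarrow>
     (\<forall>e\<in>edges G. \<exists>u v. u \<in> verts G \<and> v \<in> verts G \<and> u \<noteq> v \<and> e = {u, v})"

definition induced_subgraph :: "'a ugraph \<Rightarrow> 'a ugraph \<Rightarrow> bool" where
  "induced_subgraph H G \<longleftrightarrow>
     verts H \<subseteq> verts G \<and> edges H = {e \<in> edges G. e \<subseteq> verts H}"

definition relabel :: "('a \<Rightarrow> 'b) \<Rightarrow> 'a ugraph \<Rightarrow> 'b ugraph" where
  "relabel f G = \<lparr>verts = f ` verts G, edges = (\<lambda>e. f ` e) ` edges G\<rparr>"

text \<open>In a mixed graph, \<open>edges\<close> holds only the undirected edges;
  \<open>(u, v) \<in> arcs M\<close> is the arc from \<open>u\<close> to \<open>v\<close>.\<close>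

record 'a mgraph = "'a ugraph" +
  arcs :: "('a \<times> 'a) set"

definition mixed_graph :: "'a mgraph \<Rightarrow> bool" where
  "mixed_graph M \<longleftrightarrow>
     simple_graph M \<and>
     (\<forall>u v. (u, v) \<in> arcs M \<longrightarrow>
        u \<in> verts M \<and> v \<in> verts M \<and> u \<noteq> v \<and>
        {u, v} \<notin> edges M \<and> (v, u) \<notin> arcs M)"

definition partial_orientation :: "'a mgraph \<Rightarrow> 'a ugraph \<Rightarrow> bool" where
  "partial_orientation M G \<longleftrightarrow>
     mixed_graph M \<and> verts M = verts G \<and>
     edges G = edges M \<union> {{u, v} | u v. (u, v) \<in> arcs M}"

definition joined :: "'a mgraph \<Rightarrow> 'a \<Rightarrow> 'a \<Rightarrow> bool" where
  "joined M u v \<longleftrightarrow> {u, v} \<in> edges M \<or> (u, v) \<in> arcs M \<or> (v, u) \<in> arcs M"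

definition two_dipath :: "'a mgraph \<Rightarrow> 'a \<Rightarrow> 'a \<Rightarrow> 'a \<Rightarrow> bool" where
  "two_dipath M u v w \<longleftrightarrow> (u, v) \<in> arcs M \<and> (v, w) \<in> arcs M \<and> u \<noteq> w"

definition induced_two_dipath :: "'a mgraph \<Rightarrow> 'a \<Rightarrow> 'a \<Rightarrow> 'a \<Rightarrow> bool" where
  "induced_two_dipath M u v w \<longleftrightarrow> two_dipath M u v w \<and> \<not> joined M u w"

definition quasi_transitive :: "'a mgraph \<Rightarrow> bool" where
  "quasi_transitive M \<longleftrightarrow>
     mixed_graph M \<and>
     (\<nexists>u v w. induced_two_dipath M u v w) \<and>
     (\<forall>u v. {u, v} \<in> edges M \<longrightarrow> (\<exists>w. two_dipath M u w v \<or> two_dipath M v w u))"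

end

theory Submission
  imports Defs
begin

text \<open>Joining the ends of all 2-dipaths of an oriented graph by undirected edges closes every
  2-dipath, gives every edge a witness, and creates no new arcs. The result is therefore a
  quasi-transitive mixed graph as soon as no new edge runs parallel to an arc, for instance when the
  oriented graph is bipartite. Apply this to the oriented graph that has, for each ordered pair
  \<open>(u, v)\<close> of adjacent vertices of \<open>\<Gamma>\<close>, a new vertex \<open>w\<^bsub>uv\<^esub>\<close> and arcs \<open>u \<rightarrow> w\<^bsub>uv\<^esub> \<rightarrow> v\<close>: every arc
  joins an old vertex to a new one, and the 2-dipaths between old vertices recover exactly the
  edges of \<open>\<Gamma>\<close>.\<close>

lemma simple_graph_edgeE:
  assumes "simple_graph G" "e \<in> edges G"
  obtains u v where "e = {u, v}" "u \<in> verts G" "v \<in> verts G" "u \<noteq> v"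
  using assms unfolding simple_graph_def by blast

lemma induced_subgraph_relabelI:
  assumes "simple_graph G" "simple_graph H" "f ` verts G \<subseteq> verts H"
    and edge_iff: "\<And>u v. u \<in> verts G \<Longrightarrow> v \<in> verts G \<Longrightarrow> {f u, f v} \<in> edges H \<longleftrightarrow> {u, v} \<in> edges G"
  shows "induced_subgraph (relabel f G) H"
proof -
  have "(`) f ` edges G = {e \<in> edges H. e \<subseteq> f ` verts G}"
  proof (intro equalityI subsetI)
    fix e
    assume "e \<in> (`) f ` edges G"
    then obtain u v where "{u, v} \<in> edges G" "u \<in> verts G" "v \<in> verts G" "e = {f u, f v}"
      using assms(1) by (auto elim!: simple_graph_edgeE)
    then show "e \<in> {e \<in> edges H. e \<subseteq> f ` verts G}"
      using edge_iff by auto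
  next
    fix e
    assume "e \<in> {e \<in> edges H. e \<subseteq> f ` verts G}"
    then obtain u v where uv: "u \<in> verts G" "v \<in> verts G" "e = {f u, f v}" "e \<in> edges H"
      using assms(2) by (auto elim!: simple_graph_edgeE)
    then have "{u, v} \<in> edges G"
      using edge_iff by blast
    then have "f ` {u, v} \<in> (`) f ` edges G"
      by (rule imageI)
    with uv show "e \<in> (`) f ` edges G"
      by simp
  qed
  then show ?thesis
    using assms(3) by (simp add: induced_subgraph_def relabel_def)
qed

definition adjacency :: "('a, 'b) ugraph_scheme \<Rightarrow> ('a \<times> 'a) set" where
  "adjacency G = {(u, v). {u, v} \<in> edges G}"

lemma irrefl_adjacency: "simple_graph G \<Longrightarrow> irrefl (adjacency G)"
  by (auto simp: irrefl_def adjacency_def elim!: simple_graph_edgeE)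

lemma adjacency_subset: "simple_graph G \<Longrightarrow> adjacency G \<subseteq> verts G \<times> verts G"
  by (auto simp: adjacency_def doubleton_eq_iff elim!: simple_graph_edgeE)

definition underlying_graph :: "'a mgraph \<Rightarrow> 'a ugraph" where
  "underlying_graph M =
     \<lparr>verts = verts M, edges = edges M \<union> {{u, v} | u v. (u, v) \<in> arcs M}\<rparr>"

lemma verts_underlying_graph [simp]: "verts (underlying_graph M) = verts M"
  by (simp add: underlying_graph_def)

lemma edge_underlying_graph_iff: "{u, v} \<in> edges (underlying_graph M) \<longleftrightarrow> joined M u v"
  by (auto simp: underlying_graph_def joined_def doubleton_eq_iff)

lemma partial_orientation_underlying_graph:
  "mixed_graph M \<Longrightarrow> partial_orientation M (underlying_graph M)"
  by (simp add: partial_orientation_def underlying_graph_def)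

lemma simple_graph_underlying_graph:
  "mixed_graph M \<Longrightarrow> simple_graph (underlying_graph M)"
  unfolding mixed_graph_def simple_graph_def underlying_graph_def ugraph.simps by blast

definition dipath_closure :: "'a set \<Rightarrow> ('a \<times> 'a) set \<Rightarrow> 'a mgraph" where
  "dipath_closure V A =
     \<lparr>verts = V \<union> Field A, edges = {{u, w} | u w. (u, w) \<in> A O A}, arcs = A\<rparr>"

lemma dipath_closure_simps [simp]:
  "verts (dipath_closure V A) = V \<union> Field A"
  "arcs (dipath_closure V A) = A"
  "{u, w} \<in> edges (dipath_closure V A) \<longleftrightarrow> (u, w) \<in> A O A \<or> (w, u) \<in> A O A"
  by (auto simp: dipath_closure_def doubleton_eq_iff)

definition triangle_free :: "('a \<times> 'a) set \<Rightarrow> bool" where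
  "triangle_free A \<longleftrightarrow> (A \<union> A\<inverse>) \<inter> A O A = {}"

lemma mixed_graph_dipath_closure:
  assumes "asym A" "triangle_free A"
  shows "mixed_graph (dipath_closure V A)"
proof -
  have "simple_graph (dipath_closure V A)"
    unfolding simple_graph_def
  proof
    fix e
    assume "e \<in> edges (dipath_closure V A)"
    then obtain u v w where "e = {u, w}" "(u, v) \<in> A" "(v, w) \<in> A"
      by (auto simp: dipath_closure_def)
    moreover from this have "u \<noteq> w"
      using \<open>asym A\<close> by (auto dest: asymD)
    ultimately show "\<exists>u w. u \<in> verts (dipath_closure V A) \<and> w \<in> verts (dipath_closure V A) \<and>
        u \<noteq> w \<and> e = {u, w}"
      by (auto intro: FieldI1 FieldI2)
  qed
  moreover have "u \<noteq> v" "{u, v} \<notin> edges (dipath_closure V A)" "(v, u) \<notin> A"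
    if "(u, v) \<in> A" for u v
    using that assms by (auto simp: triangle_free_def dest: asymD)
  ultimately show ?thesis
    by (auto simp: mixed_graph_def intro: FieldI1 FieldI2)
qed

lemma quasi_transitive_dipath_closure:
  assumes "asym A" "triangle_free A"
  shows "quasi_transitive (dipath_closure V A)"
proof -
  have "joined (dipath_closure V A) u w" if "two_dipath (dipath_closure V A) u v w" for u v w
    using that by (auto simp: two_dipath_def joined_def)
  moreover have "\<exists>v. two_dipath (dipath_closure V A) u v w" if "(u, w) \<in> A O A" for u w
    using that \<open>asym A\<close> by (auto simp: two_dipath_def dest: asymD)
  ultimately show ?thesis
    using mixed_graph_dipath_closure[OF assms]
    unfolding quasi_transitive_def induced_two_dipath_def dipath_closure_simps by blast
qed

lemma bipartite_imp_triangle_free: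
  assumes "A \<subseteq> X \<times> Y \<union> Y \<times> X" "X \<inter> Y = {}"
  shows "triangle_free A"
proof -
  have "A O A \<subseteq> X \<times> X \<union> Y \<times> Y"
    using assms by blast
  then show ?thesis
    using assms unfolding triangle_free_def by blast
qed

definition subdivision :: "('a \<times> 'a) set \<Rightarrow> (('a + 'a list) \<times> ('a + 'a list)) set" where
  "subdivision R =
     (\<lambda>(u, v). (Inl u, Inr [u, v])) ` R \<union> (\<lambda>(u, v). (Inr [u, v], Inl v)) ` R"

lemma finite_subdivision: "finite R \<Longrightarrow> finite (subdivision R)"
  by (simp add: subdivision_def)

lemma asym_subdivision: "irrefl R \<Longrightarrow> asym (subdivision R)"
  by (auto simp: subdivision_def irrefl_def intro!: asymI)

lemma subdivision_bipartite:
  "subdivision R \<subseteq> range Inl \<times> range Inr \<union> range Inr \<times> range Inl"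
  by (auto simp: subdivision_def)

lemma quasi_transitive_dipath_closure_subdivision:
  assumes "irrefl R"
  shows "quasi_transitive (dipath_closure V (subdivision R))"
proof (rule quasi_transitive_dipath_closure)
  show "asym (subdivision R)"
    using assms by (rule asym_subdivision)
  show "triangle_free (subdivision R)"
    using subdivision_bipartite by (rule bipartite_imp_triangle_free) auto
qed

lemma Inl_Inl_in_subdivision_square_iff:
  "(Inl u, Inl v) \<in> subdivision R O subdivision R \<longleftrightarrow> (u, v) \<in> R"
  by (force simp: subdivision_def)

lemma joined_dipath_closure_subdivision_iff:
  "joined (dipath_closure V (subdivision R)) (Inl u) (Inl v) \<longleftrightarrow> (u, v) \<in> R \<or> (v, u) \<in> R"
proof -
  have "(Inl a, Inl b) \<notin> subdivision R" for a b
    using subdivision_bipartite by blast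
  then show ?thesis
    by (simp add: joined_def Inl_Inl_in_subdivision_square_iff)
qed

theorem theorem2p1:
  fixes \<Gamma> :: "'a ugraph"
  assumes "simple_graph \<Gamma>"
  shows "\<exists>\<Gamma>' :: ('a + 'a list) ugraph.
           simple_graph \<Gamma>' \<and>
           (finite (verts \<Gamma>) \<longrightarrow> finite (verts \<Gamma>')) \<and>
           (\<exists>M. partial_orientation M \<Gamma>' \<and> quasi_transitive M) \<and>
           induced_subgraph (relabel Inl \<Gamma>) \<Gamma>'"
proof (intro exI conjI impI)
  let ?M = "dipath_closure (Inl ` verts \<Gamma>) (subdivision (adjacency \<Gamma>))"
  let ?\<Gamma>' = "underlying_graph ?M"
  show "quasi_transitive ?M"
    using assms by (intro quasi_transitive_dipath_closure_subdivision irrefl_adjacency)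
  then have "mixed_graph ?M"
    by (simp add: quasi_transitive_def)
  then show "simple_graph ?\<Gamma>'" "partial_orientation ?M ?\<Gamma>'"
    by (rule simple_graph_underlying_graph, rule partial_orientation_underlying_graph)
  show "finite (verts ?\<Gamma>')" if "finite (verts \<Gamma>)"
    using that finite_subset[OF adjacency_subset[OF assms]]
    by (simp add: finite_Field finite_subdivision)
  have "{Inl u, Inl v} \<in> edges ?\<Gamma>' \<longleftrightarrow> {u, v} \<in> edges \<Gamma>" for u v
    by (simp add: edge_underlying_graph_iff joined_dipath_closure_subdivision_iff
        adjacency_def insert_commute)
  with assms \<open>simple_graph ?\<Gamma>'\<close> show "induced_subgraph (relabel Inl \<Gamma>) ?\<Gamma>'"
    by (intro induced_subgraph_relabelI) auto
qed

end
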